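(* The following two assertions are equivalent. (A) For every positive rational number $r$, if the gap sequence $(\varepsilon_n)_{n=1}^\infty$ of the pseudo-greedy expansion of $r$ satisfies $\lim_{n\to\infty}\varepsilon_n=0$, then there exists $n_0$ such that $\varepsilon_n=0$ for all $n\geq n_0$. (B) For every sequence of positive integers $(a_n)_{n=1}^\infty$ satisfying \[ \lim_{n\to \infty}\frac{a_n^2}{a_{n+1}}=1\quad\text{and}\quad \sum_{n=1}^\infty \frac{1}{a_n}\in \mathbb{Q} \] (in particular the series converges), there exists $n_0$ such that $a_{n+1}=a_n^2-a_n+1$ for all $n\geq n_0$.
   Context: For real $x$, $\lfloor x\rceil:=\lfloor x+\tfrac12\rfloor$. For a positive real number $r$, its pseudo-greedy expansion is the sequence of positive integers $(a_n)_{n=1}^\infty$ defined recursively by \[ a_n=\left\lfloor \left(r-\sum_{k=1}^{n-1}\frac{1}{a_k}\right)^{-1}+1\right\rceil . \] (The quantities $r-\sum_{k=1}^{n-1}1/a_k$ are always positive.) Its gap sequence $(\varepsilon_n)_{n=1}^\infty$ is defined by \[ \varepsilon_n=\left(r-\sum_{k=1}^{n-1}\frac{1}{a_k}\right)^{-1}+1-a_n . \] *)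

theory Defs imports Complex_Main begin

text \<open>
  Sequences are indexed from 0, so index \<open>n\<close> here is index \<open>n + 1\<close> in the usual presentation.
  The nearest-integer function is the library's \<^const>\<open>round\<close>, which by definition
  is \<open>\<lfloor>x + 1/2\<rfloor>\<close>.
\<close>

fun pseudo_greedy :: "real \<Rightarrow> nat \<Rightarrow> int" where
  "pseudo_greedy r n =
     round (inverse (r - (\<Sum>k<n. 1 / real_of_int (pseudo_greedy r k))) + 1)"

declare pseudo_greedy.simps [simp del]

definition gap :: "real \<Rightarrow> nat \<Rightarrow> real" where
  "gap r n =
     inverse (r - (\<Sum>k<n. 1 / real_of_int (pseudo_greedy r k))) + 1
       - real_of_int (pseudo_greedy r n)"

text \<open>For positive \<open>r\<close> no remainder vanishes, so \<^const>\<open>inverse\<close> is never applied to 0.\<close>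

lemma pseudo_greedy_remainder_pos:
  assumes "r > 0"
  shows "r - (\<Sum>k<n. 1 / real_of_int (pseudo_greedy r k)) > 0"
proof (induction n)
  case 0
  then show ?case using assms by simp
next
  case (Suc n)
  define x where "x = r - (\<Sum>k<n. 1 / real_of_int (pseudo_greedy r k))"
  have x: "x > 0" using Suc by (simp add: x_def)
  have a: "pseudo_greedy r n = round (inverse x + 1)"
    unfolding x_def by (rule pseudo_greedy.simps)
  have "real_of_int (pseudo_greedy r n) > inverse x"
    unfolding a round_def by linarith
  then have "1 / real_of_int (pseudo_greedy r n) < x"
    using x by (metis inverse_eq_divide inverse_inverse_eq inverse_positive_iff_positive less_imp_inverse_less)
  then show ?case by (simp add: x_def)
qed

lemma pseudo_greedy_pos:
  assumes "r > 0"
  shows "pseudo_greedy r n > 0"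
proof -
  have "inverse (r - (\<Sum>k<n. 1 / real_of_int (pseudo_greedy r k))) > 0"
    using pseudo_greedy_remainder_pos[OF assms] by simp
  then show ?thesis
    unfolding pseudo_greedy.simps[of r n] round_def by linarith
qed

end

theory Submission imports Defs begin

text \<open>
  Write \<open>x\<^sub>n\<close> for the remainder \<open>r - (1/a\<^sub>0 + \<dots> + 1/a\<^bsub>n-1\<^esub>)\<close>, so that
  \<open>\<epsilon>\<^sub>n = 1/x\<^sub>n + 1 - a\<^sub>n\<close>. From \<open>x\<^bsub>n+1\<^esub> = x\<^sub>n - 1/a\<^sub>n\<close> one gets
  \<open>a\<^bsub>n+1\<^esub> = a\<^sub>n (a\<^sub>n - 1 + \<epsilon>\<^sub>n) / (1 - \<epsilon>\<^sub>n) + 1 - \<epsilon>\<^bsub>n+1\<^esub>\<close>, so \<open>\<epsilon>\<^sub>n \<longlonglongrightarrow> 0\<close> forces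
  \<open>a\<^sub>n\<^sup>2 / a\<^bsub>n+1\<^esub> \<longlonglongrightarrow> 1\<close>. If \<open>a\<^bsub>n+1\<^esub> = a\<^sub>n\<^sup>2 - a\<^sub>n + 1\<close> eventually, then
  \<open>x\<^sub>n - 1/(a\<^sub>n - 1)\<close> is eventually constant and tends to 0, whence \<open>\<epsilon>\<^sub>n = 0\<close>.
  Conversely, if \<open>a\<^sub>n\<^sup>2 / a\<^bsub>n+1\<^esub> \<longlonglongrightarrow> 1\<close> then the tails \<open>x\<^sub>n\<close> of \<open>\<Sum> 1/a\<^sub>n\<close> satisfy
  \<open>x\<^sub>n a\<^sub>n \<longlonglongrightarrow> 1\<close>, hence \<open>a\<^sub>n - 1/x\<^sub>n = a\<^sub>n\<^sup>2 x\<^bsub>n+1\<^esub> / (1 + a\<^sub>n x\<^bsub>n+1\<^esub>) \<longlonglongrightarrow> 1\<close>; so from some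
  index \<open>N\<close> on, \<open>a\<close> is the pseudo-greedy expansion of \<open>x\<^sub>N\<close>, with gaps tending to 0.
\<close>

section \<open>Asymptotics of the tails of a series of reciprocals\<close>

lemma filterlim_at_top_if_summable_inverse:
  fixes b :: "nat \<Rightarrow> real"
  assumes "\<And>n. b n > 0" and "summable (\<lambda>n. 1 / b n)"
  shows "filterlim b at_top sequentially"
proof -
  have "(\<lambda>n. 1 / b n) \<longlonglongrightarrow> 0"
    using assms(2) by (rule summable_LIMSEQ_zero)
  then have "filterlim (\<lambda>n. inverse (1 / b n)) at_top sequentially"
    by (rule filterlim_inverse_at_top) (simp add: assms(1))
  then show ?thesis by (simp add: field_simps)
qed

lemma suminf_tail_Suc:
  fixes f :: "nat \<Rightarrow> real"
  assumes "summable f"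
  shows "(\<Sum>k. f (k + n)) = f n + (\<Sum>k. f (k + Suc n))"
  using suminf_split_head[of "\<lambda>k. f (k + n)"] assms
  by (simp add: summable_ignore_initial_segment)

text \<open>Summing the eventual bound \<open>f (Suc n) \<le> q * f n\<close> termwise shows that
  the quotients of consecutive tails tend to 0 as well. Since \<open>f n\<close> is the difference
  of two consecutive tails, the tail is asymptotic to its first term.\<close>

lemma tail_over_head_tendsto_1:
  fixes f :: "nat \<Rightarrow> real"
  assumes pos: "\<And>n. f n > 0" and summ: "summable f"
    and ratio: "(\<lambda>n. f (Suc n) / f n) \<longlonglongrightarrow> 0"
  shows "(\<lambda>n. (\<Sum>k. f (k + n)) / f n) \<longlonglongrightarrow> 1"
proof -
  define x where "x n = (\<Sum>k. f (k + n))" for n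
  have s: "summable (\<lambda>k. f (k + n))" for n
    using summ by (rule summable_ignore_initial_segment)
  have xpos: "x n > 0" for n
    unfolding x_def using s pos by (rule suminf_pos)
  have xS: "x n = f n + x (Suc n)" for n
    unfolding x_def using summ by (rule suminf_tail_Suc)
  have "(\<lambda>n. x (Suc n) / x n) \<longlonglongrightarrow> 0"
  proof (rule LIMSEQ_I)
    fix e :: real assume "e > 0"
    \<comment> \<open>Summation yields only the weak bound \<open>x (Suc n) / x n \<le> q\<close>,
      so \<open>q\<close> is taken strictly below \<open>e\<close>.\<close>
    define q where "q = e / 2"
    have q: "q > 0" "q < e" using \<open>e > 0\<close> by (auto simp: q_def)
    obtain N where N: "\<And>n. n \<ge> N \<Longrightarrow> f (Suc n) / f n < q"
      using order_tendstoD(2)[OF ratio q(1)] by (auto simp: eventually_sequentially)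
    have "norm (x (Suc n) / x n - 0) < e" if "n \<ge> N" for n
    proof -
      have "f (k + Suc n) \<le> q * f (k + n)" for k
        using N[of "k + n"] pos[of "k + n"] that by (simp add: field_simps)
      then have "x (Suc n) \<le> (\<Sum>k. q * f (k + n))"
        unfolding x_def by (intro suminf_le s summable_mult)
      also have "\<dots> = q * x n"
        unfolding x_def using s by (rule suminf_mult)
      finally have "x (Suc n) / x n \<le> q"
        using xpos[of n] by (simp add: field_simps)
      then show ?thesis using q xpos[of n] xpos[of "Suc n"] by simp
    qed
    then show "\<exists>no. \<forall>n\<ge>no. norm (x (Suc n) / x n - 0) < e" by blast
  qed
  then have "(\<lambda>n. 1 / (1 - x (Suc n) / x n)) \<longlonglongrightarrow> 1 / (1 - 0)"
    by (intro tendsto_intros) auto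
  moreover have "1 / (1 - x (Suc n) / x n) = x n / f n" for n
    using xS[of n] xpos[of n] pos[of n] by (simp add: field_simps)
  ultimately show ?thesis by (simp add: x_def)
qed

text \<open>With \<open>x n\<close> the tail, \<open>x n = 1 / b n + x (Suc n)\<close> turns the gap
  into an expression in \<open>1 / b n\<close> and \<open>(b n)\<^sup>2 * x (Suc n)\<close>. The
  latter is the product of \<open>(b n)\<^sup>2 / b (Suc n)\<close> and
  \<open>b (Suc n) * x (Suc n)\<close>, both tending to 1.\<close>

lemma reciprocal_tail_gap_tendsto_0:
  fixes b :: "nat \<Rightarrow> real"
  assumes pos: "\<And>n. b n > 0"
    and lim: "(\<lambda>n. (b n)\<^sup>2 / b (Suc n)) \<longlonglongrightarrow> 1"
    and summ: "summable (\<lambda>n. 1 / b n)"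
  shows "(\<lambda>n. inverse (\<Sum>k. 1 / b (k + n)) + 1 - b n) \<longlonglongrightarrow> 0"
proof -
  define x where "x n = (\<Sum>k. 1 / b (k + n))" for n
  have xS: "x n = 1 / b n + x (Suc n)" for n
    unfolding x_def using summ by (rule suminf_tail_Suc)
  have xpos: "x n > 0" for n
    unfolding x_def using pos summ
    by (intro suminf_pos summable_ignore_initial_segment[of "\<lambda>n. 1 / b n"]) auto
  have inv0: "(\<lambda>n. 1 / b n) \<longlonglongrightarrow> 0"
    using summ by (rule summable_LIMSEQ_zero)
  have "(\<lambda>n. (b n)\<^sup>2 / b (Suc n) * (1 / b n)) \<longlonglongrightarrow> 1 * 0"
    using lim inv0 by (rule tendsto_mult)
  moreover have "(b n)\<^sup>2 / b (Suc n) * (1 / b n) = 1 / b (Suc n) / (1 / b n)" for n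
    using pos[of n] pos[of "Suc n"] by (simp add: field_simps power2_eq_square)
  ultimately have "(\<lambda>n. 1 / b (Suc n) / (1 / b n)) \<longlonglongrightarrow> 0" by simp
  then have "(\<lambda>n. x n / (1 / b n)) \<longlonglongrightarrow> 1"
    unfolding x_def using pos summ
    by (intro tail_over_head_tendsto_1[of "\<lambda>n. 1 / b n"]) auto
  then have "(\<lambda>n. x (Suc n) / (1 / b (Suc n))) \<longlonglongrightarrow> 1"
    by (rule LIMSEQ_Suc)
  then have "(\<lambda>n. (b n)\<^sup>2 / b (Suc n) * (x (Suc n) / (1 / b (Suc n)))) \<longlonglongrightarrow> 1 * 1"
    using lim by (intro tendsto_mult)
  moreover have "(b n)\<^sup>2 / b (Suc n) * (x (Suc n) / (1 / b (Suc n))) = (b n)\<^sup>2 * x (Suc n)" for n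
    using pos[of "Suc n"] by simp
  ultimately have sq: "(\<lambda>n. (b n)\<^sup>2 * x (Suc n)) \<longlonglongrightarrow> 1" by simp
  \<comment> \<open>Here \<open>b n * x (Suc n)\<close> is written as
    \<open>(b n)\<^sup>2 * x (Suc n) * (1 / b n)\<close>, so that its limit 0 follows from
    \<open>sq\<close> and \<open>inv0\<close>.\<close>
  have "(\<lambda>n. 1 - (b n)\<^sup>2 * x (Suc n) / (1 + (b n)\<^sup>2 * x (Suc n) * (1 / b n))) \<longlonglongrightarrow> 1 - 1 / (1 + 1 * 0)"
    using sq inv0 by (intro tendsto_intros) auto
  moreover have "1 - (b n)\<^sup>2 * x (Suc n) / (1 + (b n)\<^sup>2 * x (Suc n) * (1 / b n))
      = inverse (x n) + 1 - b n" for n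
  proof -
    have D: "1 + b n * x (Suc n) > 0"
      using pos[of n] xpos[of "Suc n"] by (simp add: add_pos_pos)
    have "x n = (1 + b n * x (Suc n)) / b n"
      using pos[of n] by (subst xS) (simp add: field_simps)
    then have inv: "inverse (x n) = b n / (1 + b n * x (Suc n))" by simp
    have "(b n)\<^sup>2 * x (Suc n) * (1 / b n) = b n * x (Suc n)"
      using pos[of n] by (simp add: power2_eq_square)
    then show ?thesis
      unfolding inv using D by (simp add: field_simps power2_eq_square)
  qed
  ultimately have "(\<lambda>n. inverse (x n) + 1 - b n) \<longlonglongrightarrow> 1 - 1 / (1 + 1 * 0)"
    by (simp only:)
  then show ?thesis by (simp add: x_def)
qed

section \<open>From eventually vanishing gaps to the Sylvester recursion\<close>

lemma pseudo_greedy_eqI: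
  assumes "\<And>n. a n = round (inverse (r - (\<Sum>k<n. 1 / real_of_int (a k))) + 1)"
  shows "pseudo_greedy r n = a n"
proof (induction n rule: less_induct)
  case (less n)
  then have "(\<Sum>k<n. 1 / real_of_int (pseudo_greedy r k)) = (\<Sum>k<n. 1 / real_of_int (a k))"
    by (intro sum.cong) auto
  then show ?case
    by (simp add: pseudo_greedy.simps[of r n] assms[of n])
qed

lemma sylvester_if_gap_rigidity:
  fixes a :: "nat \<Rightarrow> int"
  assumes rigid: "\<And>r. r > 0 \<Longrightarrow> r \<in> \<rat> \<Longrightarrow> gap r \<longlonglongrightarrow> 0 \<Longrightarrow> \<exists>n0. \<forall>n\<ge>n0. gap r n = 0"
    and pos: "\<And>n. a n > 0"
    and lim: "(\<lambda>n. (real_of_int (a n))\<^sup>2 / real_of_int (a (Suc n))) \<longlonglongrightarrow> 1"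
    and summ: "summable (\<lambda>n. 1 / real_of_int (a n))"
    and rat: "(\<Sum>n. 1 / real_of_int (a n)) \<in> \<rat>"
  shows "\<exists>n0. \<forall>n\<ge>n0. a (Suc n) = (a n)\<^sup>2 - a n + 1"
proof -
  define f where "f n = 1 / real_of_int (a n)" for n
  define x where "x n = (\<Sum>k. f (k + n))" for n
  have summ_f: "summable f" using summ by (simp add: f_def[abs_def])
  have xpos: "x n > 0" for n
    unfolding x_def using pos
    by (intro suminf_pos summable_ignore_initial_segment[OF summ_f]) (auto simp: f_def)
  have x_split: "x N = x (n + N) + (\<Sum>k<n. f (k + N))" for N n
    using suminf_split_initial_segment[of "\<lambda>k. f (k + N)" n] summ_f
    by (simp add: x_def summable_ignore_initial_segment add.assoc)
  define e where "e n = inverse (x n) + 1 - real_of_int (a n)" for n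
  have e: "e \<longlonglongrightarrow> 0"
    unfolding e_def x_def f_def
    by (rule reciprocal_tail_gap_tendsto_0) (use pos lim summ in auto)
  \<comment> \<open>Below 1/2 the gap determines the rounding: \<open>a n\<close> is then the
    integer nearest to \<open>inverse (x n) + 1\<close>, with no tie.\<close>
  obtain N where N: "\<And>n. n \<ge> N \<Longrightarrow> \<bar>e n\<bar> < 1/2"
    using LIMSEQ_D[OF e, of "1/2"] by auto
  have rem: "x N - (\<Sum>k<n. 1 / real_of_int (a (k + N))) = x (n + N)" for n
    using x_split[of N n] by (simp add: f_def)
  have pg: "pseudo_greedy (x N) n = a (n + N)" for n
  proof (rule pseudo_greedy_eqI)
    fix n
    have "\<bar>real_of_int (a (n + N)) - (inverse (x (n + N)) + 1)\<bar> < 1/2"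
      using N[of "n + N"] unfolding e_def by linarith
    then show "a (n + N) = round (inverse (x N - (\<Sum>k<n. 1 / real_of_int (a (k + N)))) + 1)"
      unfolding rem by (intro round_unique'[symmetric]) (simp add: abs_minus_commute)
  qed
  have gap: "gap (x N) n = e (n + N)" for n
    by (simp add: gap_def pg rem e_def)
  \<comment> \<open>The tail \<open>x N\<close> stays rational, as it differs from the whole sum by
    finitely many unit fractions.\<close>
  have "x 0 \<in> \<rat>" using rat by (simp add: x_def f_def)
  moreover have "x 0 = x N + (\<Sum>k<N. f k)" using x_split[of 0 N] by simp
  moreover have "(\<Sum>k<N. f k) \<in> \<rat>" by (intro Rats_sum) (simp add: f_def)
  ultimately have "x N \<in> \<rat>" by (metis Rats_diff add_diff_cancel_right')
  moreover have "gap (x N) \<longlonglongrightarrow> 0"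
    using LIMSEQ_ignore_initial_segment[OF e, of N] by (simp add: gap[abs_def])
  ultimately obtain m where m: "\<And>n. n \<ge> m \<Longrightarrow> e (n + N) = 0"
    using rigid[of "x N"] xpos by (auto simp: gap)
  have x_eq: "inverse (x n) = real_of_int (a n) - 1" if "n \<ge> m + N" for n
    using m[of "n - N"] le_diff_conv2[of N n m] that by (simp add: e_def)
  have "a (Suc n) = (a n)\<^sup>2 - a n + 1" if "n \<ge> m + N" for n
  proof -
    define A B where "A = real_of_int (a n)" and "B = real_of_int (a (Suc n))"
    have inv: "inverse (x n) = A - 1" "inverse (x (Suc n)) = B - 1"
      using that x_eq[of n] x_eq[of "Suc n"] by (auto simp: A_def B_def)
    then have "A - 1 > 0" "B - 1 > 0"
      using xpos[of n] xpos[of "Suc n"] by (metis inverse_positive_iff_positive)+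
    moreover have "x n = 1 / A + x (Suc n)"
      using x_split[of n 1] by (simp add: A_def f_def)
    \<comment> \<open>Two consecutive zero gaps leave only this identity of unit fractions, which
      says \<open>B - 1 = A * (A - 1)\<close>.\<close>
    then have "1 / (A - 1) = 1 / A + 1 / (B - 1)"
      using inv by (metis inverse_eq_divide inverse_inverse_eq)
    ultimately have "B = A\<^sup>2 - A + 1"
      by (simp add: field_simps power2_eq_square)
    then show ?thesis
      unfolding A_def B_def by (metis (no_types) of_int_1 of_int_add of_int_diff of_int_eq_iff of_int_power)
  qed
  then show ?thesis by blast
qed

section \<open>From the Sylvester recursion to eventually vanishing gaps\<close>

lemma summable_pseudo_greedy:
  assumes "r > 0"
  shows "summable (\<lambda>n. 1 / real_of_int (pseudo_greedy r n))"
proof (rule bounded_imp_summable)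
  show "1 / real_of_int (pseudo_greedy r n) \<ge> 0" for n
    using pseudo_greedy_pos[OF assms, of n] by simp
  show "(\<Sum>k\<le>n. 1 / real_of_int (pseudo_greedy r k)) \<le> r" for n
    using pseudo_greedy_remainder_pos[OF assms, of "Suc n"] by (simp add: lessThan_Suc_atMost)
qed

lemma gap_eventually_zero_if_sylvester_rigidity:
  fixes r :: real
  assumes rigid: "\<And>a :: nat \<Rightarrow> int. (\<And>n. a n > 0) \<Longrightarrow>
      (\<lambda>n. (real_of_int (a n))\<^sup>2 / real_of_int (a (Suc n))) \<longlonglongrightarrow> 1 \<Longrightarrow>
      summable (\<lambda>n. 1 / real_of_int (a n)) \<Longrightarrow>
      (\<Sum>n. 1 / real_of_int (a n)) \<in> \<rat> \<Longrightarrow>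
      \<exists>n0. \<forall>n\<ge>n0. a (Suc n) = (a n)\<^sup>2 - a n + 1"
    and r: "r > 0" "r \<in> \<rat>" and gap0: "gap r \<longlonglongrightarrow> 0"
  shows "\<exists>n0. \<forall>n\<ge>n0. gap r n = 0"
proof -
  define a where "a = pseudo_greedy r"
  define b where "b n = real_of_int (a n)" for n
  define x where "x n = r - (\<Sum>k<n. 1 / b k)" for n
  define e where "e = gap r"
  have e: "e \<longlonglongrightarrow> 0" using gap0 by (simp add: e_def)
  have apos: "a n > 0" for n
    unfolding a_def using pseudo_greedy_pos[OF r(1)] .
  have bpos: "b n > 0" for n using apos by (simp add: b_def)
  have xpos: "x n > 0" for n
    using pseudo_greedy_remainder_pos[OF r(1)] by (simp add: x_def b_def a_def)
  have e_eq: "e n = inverse (x n) + 1 - b n" for n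
    by (simp add: e_def gap_def x_def b_def a_def)
  have xS: "x (Suc n) = x n - 1 / b n" for n by (simp add: x_def)
  have summ: "summable (\<lambda>n. 1 / b n)"
    using summable_pseudo_greedy[OF r(1)] by (simp add: b_def a_def)
  have btop: "filterlim b at_top sequentially"
    using bpos summ by (rule filterlim_at_top_if_summable_inverse)
  have inv0: "(\<lambda>n. 1 / b n) \<longlonglongrightarrow> 0"
    using summ by (rule summable_LIMSEQ_zero)
  \<comment> \<open>This keeps \<open>1 - e n\<close> nonzero when \<open>b_rec\<close> is divided
    by \<open>(b n)\<^sup>2\<close> below.\<close>
  have e1: "e n < 1" for n
  proof -
    have "1 / b n < x n" using xpos[of "Suc n"] by (simp add: xS)
    then have "inverse (x n) < b n"
      using bpos[of n] xpos[of n] by (simp add: field_simps)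
    then show ?thesis by (simp add: e_eq)
  qed
  have b_rec: "b (Suc n) = b n * (b n - 1 + e n) / (1 - e n) + 1 - e (Suc n)" for n
  proof -
    have y: "inverse (x n) = b n - 1 + e n" by (simp add: e_eq)
    then have xn: "x n = 1 / (b n - 1 + e n)" and ypos: "b n - 1 + e n > 0"
      using xpos[of n] by (metis inverse_eq_divide inverse_inverse_eq, metis inverse_positive_iff_positive)
    have "x (Suc n) = (1 - e n) / (b n * (b n - 1 + e n))"
      using bpos[of n] ypos by (simp add: xS xn field_simps)
    then show ?thesis using e_eq[of "Suc n"] by simp
  qed
  \<comment> \<open>Positivity of the remainders only bounds the sum of the series by
    \<open>r\<close>. Equality comes from the gaps: \<open>inverse (x n)\<close> is
    \<open>b n\<close> plus a convergent term, hence unbounded growth.\<close>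
  have x0: "x \<longlonglongrightarrow> 0"
  proof -
    have "filterlim (\<lambda>n. (e n - 1) + b n) at_top sequentially"
      by (rule filterlim_tendsto_add_at_top[OF tendsto_diff[OF e tendsto_const] btop])
    then have "filterlim (\<lambda>n. inverse (x n)) at_top sequentially"
      by (simp add: e_eq)
    then have "(\<lambda>n. inverse (inverse (x n))) \<longlonglongrightarrow> 0"
      by (rule tendsto_inverse_0_at_top)
    then show ?thesis by simp
  qed
  have "(\<lambda>n. r - x n) \<longlonglongrightarrow> r - 0" by (intro tendsto_intros x0)
  then have "(\<lambda>n. 1 / b n) sums r" by (simp add: sums_def x_def)
  then have sum_r: "(\<Sum>n. 1 / b n) = r" by (rule sums_unique[symmetric])
  \<comment> \<open>Dividing \<open>b_rec\<close> by \<open>(b n)\<^sup>2\<close> expresses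
    \<open>b (Suc n) / (b n)\<^sup>2\<close> through \<open>e n\<close>, \<open>e (Suc n)\<close>
    and \<open>1 / b n\<close>, which all tend to 0.\<close>
  have "(\<lambda>n. 1 / ((1 - (1 - e n) * (1 / b n)) / (1 - e n) + (1 - e (Suc n)) * (1 / b n * (1 / b n))))
      \<longlonglongrightarrow> 1 / ((1 - (1 - 0) * 0) / (1 - 0) + (1 - 0) * (0 * 0))"
    by (intro tendsto_intros e inv0 LIMSEQ_Suc[OF e]) auto
  moreover have "1 / ((1 - (1 - e n) * (1 / b n)) / (1 - e n) + (1 - e (Suc n)) * (1 / b n * (1 / b n)))
      = (b n)\<^sup>2 / b (Suc n)" for n
  proof -
    have "(1 - (1 - e n) * (1 / b n)) / (1 - e n) + (1 - e (Suc n)) * (1 / b n * (1 / b n))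
        = b (Suc n) / (b n)\<^sup>2"
      using bpos[of n] e1[of n] unfolding b_rec[of n]
      by (simp add: field_simps power2_eq_square)
    then show ?thesis by simp
  qed
  ultimately have lim: "(\<lambda>n. (b n)\<^sup>2 / b (Suc n)) \<longlonglongrightarrow> 1" by simp
  obtain n1 where n1: "\<And>n. n \<ge> n1 \<Longrightarrow> a (Suc n) = (a n)\<^sup>2 - a n + 1"
    using rigid[of a] apos lim summ sum_r r(2) by (auto simp: b_def)
  obtain n2 where n2: "\<And>n. n \<ge> n2 \<Longrightarrow> b n > 1"
    using btop unfolding filterlim_at_top_dense eventually_sequentially by blast
  define n0 where "n0 = max n1 n2"
  \<comment> \<open>If the recursion holds from \<open>n\<close> on and \<open>b n > 1\<close>, the
    reciprocals from \<open>n\<close> on telescope to \<open>1 / (b n - 1)\<close>, because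
    \<open>1 / (b n - 1) - 1 / b n = 1 / (b n * (b n - 1))\<close>. So \<open>d\<close> compares the
    remainder with the value it should have.\<close>
  define d where "d n = x n - 1 / (b n - 1)" for n
  have d_Suc: "d (Suc n) = d n" if "n \<ge> n0" for n
  proof -
    have "b (Suc n) = (b n)\<^sup>2 - b n + 1"
      using n1[of n] that by (simp add: b_def n0_def)
    then have b_Suc: "b (Suc n) - 1 = b n * (b n - 1)" by (simp add: power2_eq_square algebra_simps)
    have "b n > 1" using n2[of n] that by (simp add: n0_def)
    then show ?thesis
      unfolding d_def xS b_Suc by (simp add: field_simps)
  qed
  have d_const: "d (k + n) = d n" if "n \<ge> n0" for n k
    using that by (induction k) (auto simp: d_Suc)
  have "filterlim (\<lambda>n. -1 + b n) at_top sequentially"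
    by (rule filterlim_tendsto_add_at_top[OF tendsto_const btop])
  then have "(\<lambda>n. inverse (b n - 1)) \<longlonglongrightarrow> 0"
    using tendsto_inverse_0_at_top by fastforce
  then have "d \<longlonglongrightarrow> 0 - 0"
    unfolding d_def using x0 by (intro tendsto_diff) (simp_all add: inverse_eq_divide)
  then have d0: "d \<longlonglongrightarrow> 0" by simp
  have "gap r n = 0" if "n \<ge> n0" for n
  proof -
    have "(\<lambda>k. d (k + n)) \<longlonglongrightarrow> 0" using d0 by (rule LIMSEQ_ignore_initial_segment)
    then have "d n = 0" using d_const[OF that] by (simp add: LIMSEQ_const_iff)
    then have "inverse (x n) = b n - 1" by (simp add: d_def)
    then show ?thesis using e_eq[of n] by (simp add: e_def)
  qed
  then show ?thesis by blast
qed

theorem theorem16: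
  shows "(\<forall>r::real. r > 0 \<longrightarrow> r \<in> \<rat> \<longrightarrow> gap r \<longlonglongrightarrow> 0 \<longrightarrow>
            (\<exists>n0. \<forall>n\<ge>n0. gap r n = 0))
     \<longleftrightarrow>
         (\<forall>a::nat \<Rightarrow> int. (\<forall>n. a n > 0) \<longrightarrow>
            (\<lambda>n. (real_of_int (a n))\<^sup>2 / real_of_int (a (Suc n))) \<longlonglongrightarrow> 1 \<longrightarrow>
            summable (\<lambda>n. 1 / real_of_int (a n)) \<longrightarrow>
            (\<Sum>n. 1 / real_of_int (a n)) \<in> \<rat> \<longrightarrow>
            (\<exists>n0. \<forall>n\<ge>n0. a (Suc n) = (a n)\<^sup>2 - a n + 1))"
  (is "?A \<longleftrightarrow> ?B")
proof
  assume ?A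
  then show ?B by (intro allI impI sylvester_if_gap_rigidity) auto
next
  assume ?B
  then show ?A by (intro allI impI gap_eventually_zero_if_sylvester_rigidity) auto
qed

end
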